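(* Let $P_{XY}$ and $Q_{XY}$ be probability distributions on $\mathbb{R}^d\times[K]$ and let $f:\mathbb{R}^d\to[K]$ be a classifier induced by a logit map $M_f:\mathbb{R}^d\to\mathbb{R}^K$, with margin $\gamma_f$ and score $s=-\gamma_f$. Assume: (A1) for all $x,x'\in\mathbb{R}^d$ and $y\in[K]$, $|\gamma_f(x,y)-\gamma_f(x',y)|\le L_\gamma\|x-x'\|_2$; (A2) $P_Y=Q_Y$, and for some $\rho>0$, $\sup_{y\in[K]}W_\infty(P_{X|y},Q_{X|y})<\rho$. Let $\rho_{\mathrm{mix}}:=\sum_{y=1}^K P_Y(y)\,W_1(P_{X|y},Q_{X|y})$. Let $X_1,\dots,X_n$ be i.i.d. from $Q_X$ and let $(X_{n+1},Y_{n+1})\sim Q_{XY}$ be independent of them; let $\mathbb{P}_Q$ denote the joint law of $X_{1:n}$ and $(X_{n+1},Y_{n+1})$. Let $\alpha\in(0,1)$, put $\tilde Y_i:=f(X_i)$ for $i\le n$, let $q_{\tilde Q,\alpha}$ be the split-conformal threshold at level $\alpha$ computed from the scores $\{s(X_i,\tilde Y_i)\}_{i=1}^n$, and define $$C^{1-\alpha}_{\tilde Q}(X_{n+1}):=\{y\in[K]: s(X_{n+1},y)\le q_{\tilde Q,\alpha}\}.$$ Then $$\mathbb{P}_Q\big(Y_{n+1}\in C^{1-\alpha}_{\tilde Q}(X_{n+1})\big)\ \ge\ \max\{0,\ 1-\alpha-L_r(f,P)-L_\gamma\rho_{\mathrm{mix}}\}.$$ Moreover, $$\mathbb{P}_Q\big(Y_{n+1}\in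 C^{1-\alpha}_{\tilde Q}(X_{n+1})\big)\ \ge\ 1-\alpha-L_r(f,Q),\qquad\text{where } L_r(f,Q)\le L_r(f,P)+L_\gamma\rho_{\mathrm{mix}}.$$
   Context: $[K]=\{1,\dots,K\}$ with $K\ge2$. $P_X,P_Y$ denote marginals of $P_{XY}$ and $P_{X|y}$ the conditional law of $X$ given $Y=y$; similarly for $Q$. Classifier and margin: for a logit map $M_f:\mathbb{R}^d\to\mathbb{R}^K$, $f(x):=\arg\max_{k\in[K]}M_f(x)_k$, with ties broken by some fixed rule; $M_f$ and $f$ are measurable. The margin is $\gamma_f(x,y):=M_f(x)_y-\max_{k\ne y}M_f(x)_k$, and the nonconformity score is $s(x,y):=-\gamma_f(x,y)$. Ramp loss: $r(t):=\min\{\max(1-t,0),1\}$ and, for a distribution $P=P_{XY}$, $L_r(f,P):=\mathbb{E}_{(X,Y)\sim P_{XY}}[r(\gamma_f(X,Y))]$; similarly $L_r(f,Q)$. Wasserstein distances on $(\mathbb{R}^d,\|\cdot\|_2)$: with $\Pi(\mu,\nu)$ the set of couplings, $W_1(\mu,\nu)=\inf_{\pi\in\Pi(\mu,\nu)}\mathbb{E}_{(X,X')\sim\pi}\|X-X'\|_2$ and $W_\infty(\mu,\nu)=\inf_{\pi\in\Pi(\mu,\nu)}\operatorname{ess\,sup}_{(X,X')\sim\pi}\|X-X'\|_2$. Split-conformal threshold: the threshold at level $\alpha$ computed from real scores $S_1,\dots,S_n$ is $\inf\{t\in\mathbb{R}:\frac1n\sum_{i=1}^n\mathbf{1}\{S_i\le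 t\}\ge \lceil(1-\alpha)(n+1)\rceil/n\}$, with $\inf\emptyset=+\infty$ (so it is $+\infty$ when $\lceil(1-\alpha)(n+1)\rceil>n$). *)

theory Defs
  imports "HOL-Probability.Probability"
begin

definition margin :: "('x \<Rightarrow> real ^ 'k) \<Rightarrow> 'x \<Rightarrow> 'k::finite \<Rightarrow> real" where
  "margin Mf x y = Mf x $ y - (MAX k\<in>UNIV - {y}. Mf x $ k)"

definition score :: "('x \<Rightarrow> real ^ 'k) \<Rightarrow> 'x \<Rightarrow> 'k::finite \<Rightarrow> real" where
  "score Mf x y = - margin Mf x y"

(* f is any selection from the argmax, so every way of breaking ties is allowed. *)
definition induced_classifier :: "('x \<Rightarrow> real ^ 'k) \<Rightarrow> ('x \<Rightarrow> 'k::finite) \<Rightarrow> bool" where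
  "induced_classifier Mf f \<longleftrightarrow> (\<forall>x. is_arg_max (\<lambda>k. Mf x $ k) (\<lambda>_. True) (f x))"

definition ramp :: "real \<Rightarrow> real" where
  "ramp t = min (max (1 - t) 0) 1"

definition ramp_loss :: "('x \<Rightarrow> real ^ 'k) \<Rightarrow> ('x \<times> 'k::finite) measure \<Rightarrow> real" where
  "ramp_loss Mf P = (\<integral>z. ramp (margin Mf (fst z) (snd z)) \<partial>P)"

abbreviation labelled_space :: "('x::topological_space \<times> 'k) measure" where
  "labelled_space \<equiv> borel \<Otimes>\<^sub>M count_space UNIV"

definition marginal_X :: "('x::topological_space \<times> 'k) measure \<Rightarrow> 'x measure" where
  "marginal_X P = distr P borel fst"

definition marginal_Y :: "('x \<times> 'k) measure \<Rightarrow> 'k measure" where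
  "marginal_Y P = distr P (count_space UNIV) snd"

(* Elementary conditioning on the event Y = y.  If that event has probability 0, the result
   is the zero measure rather than a probability law. *)
definition cond_X :: "('x::topological_space \<times> 'k) measure \<Rightarrow> 'k \<Rightarrow> 'x measure" where
  "cond_X P y = distr (uniform_measure P {z \<in> space P. snd z = y}) borel fst"

definition couplings ::
    "'x::topological_space measure \<Rightarrow> 'x measure \<Rightarrow> ('x \<times> 'x) measure set" where
  "couplings \<mu> \<nu> =
     {\<pi>. sets \<pi> = sets (borel \<Otimes>\<^sub>M borel) \<and> distr \<pi> borel fst = \<mu> \<and> distr \<pi> borel snd = \<nu>}"

definition W1 :: "'x::real_normed_vector measure \<Rightarrow> 'x measure \<Rightarrow> ennreal" where
  "W1 \<mu> \<nu> = (INF \<pi>\<in>couplings \<mu> \<nu>. \<integral>\<^sup>+z. ennreal (norm (fst z - snd z)) \<partial>\<pi>)"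

definition Winf :: "'x::real_normed_vector measure \<Rightarrow> 'x measure \<Rightarrow> ennreal" where
  "Winf \<mu> \<nu> = (INF \<pi>\<in>couplings \<mu> \<nu>. esssup \<pi> (\<lambda>z. ennreal (norm (fst z - snd z))))"

(* Used only where the conditional laws have finite W1 distance for every label of positive
   probability; labels of probability 0 do not contribute. *)
definition rho_mix ::
    "('x::real_normed_vector \<times> 'k::finite) measure \<Rightarrow> ('x \<times> 'k) measure \<Rightarrow> real" where
  "rho_mix P Q =
     (\<Sum>y\<in>UNIV. measure (marginal_Y P) {y} * enn2real (W1 (cond_X P y) (cond_X Q y)))"

(* The infimum is taken in the extended reals, so that it is \<infinity> for the empty set. *)
definition split_conformal_threshold :: "real \<Rightarrow> nat \<Rightarrow> (nat \<Rightarrow> real) \<Rightarrow> ereal" where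
  "split_conformal_threshold \<alpha> n S =
     Inf (ereal ` {t. (1 / real n) * (\<Sum>i=1..n. of_bool (S i \<le> t))
                        \<ge> of_int \<lceil>(1 - \<alpha>) * (real n + 1)\<rceil> / real n})"

definition conformal_set ::
    "('x \<Rightarrow> real ^ 'k) \<Rightarrow> ('x \<Rightarrow> 'k::finite) \<Rightarrow> real \<Rightarrow> nat \<Rightarrow> (nat \<Rightarrow> 'x) \<Rightarrow> 'x \<Rightarrow> 'k set" where
  "conformal_set Mf f \<alpha> n xs x =
     {y. ereal (score Mf x y) \<le> split_conformal_threshold \<alpha> n (\<lambda>i. score Mf (xs i) (f (xs i)))}"

(* indep_var for two random variables with values in different types *)
definition indep_var_het ::
    "'w measure \<Rightarrow> 'a measure \<Rightarrow> ('w \<Rightarrow> 'a) \<Rightarrow> 'b measure \<Rightarrow> ('w \<Rightarrow> 'b) \<Rightarrow> bool" where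
  "indep_var_het M Ma A Mb B \<longleftrightarrow>
     A \<in> M \<rightarrow>\<^sub>M Ma \<and> B \<in> M \<rightarrow>\<^sub>M Mb \<and>
     prob_space.indep_set M {A -` S \<inter> space M | S. S \<in> sets Ma} {B -` S \<inter> space M | S. S \<in> sets Mb}"

end

theory Submission
  imports Defs
begin

text \<open>
  For the coverage bound, compare with the oracle label \<open>f X\<^bsub>n+1\<^esub>\<close>: the \<open>n + 1\<close> scores
  \<open>s(X\<^sub>i, f X\<^sub>i)\<close> are i.i.d., so the usual rank argument shows that the last one exceeds the threshold
  with probability at most \<open>\<alpha>\<close>. The true label can only be missed on that event or on
  \<open>f X\<^bsub>n+1\<^esub> \<noteq> Y\<^bsub>n+1\<^esub>\<close>, where the margin is nonpositive and the ramp loss equals 1.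
  For the comparison of the ramp losses, disintegrate over the label and use that the ramp loss is
  \<open>L\<^sub>\<gamma>\<close>-Lipschitz in \<open>x\<close> under every coupling of the conditional laws.
\<close>

section \<open>Ranks of i.i.d. scores\<close>

lemma pred_le_card_Collect:
  assumes "finite I" and [measurable]: "\<And>i. i \<in> I \<Longrightarrow> Measurable.pred M (R i)"
  shows "Measurable.pred M (\<lambda>x. k \<le> card {i \<in> I. R i x})"
proof -
  have "k \<le> card {i \<in> I. R i x} \<longleftrightarrow> real k \<le> (\<Sum>i\<in>I. if R i x then 1 else 0)" for x
    using \<open>finite I\<close> by (simp add: sum.If_cases Int_def)
  then show ?thesis by simp
qed

text \<open>Among the indices counted on the left, pick one with the smallest value. At least
  \<open>k\<close> indices lie strictly below it, and by minimality none of those is itself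
  counted.\<close>

lemma card_rank_ge_le:
  fixes h :: "'i \<Rightarrow> real"
  assumes "finite I" "k \<le> card I"
  shows "card {j \<in> I. k \<le> card {i \<in> I. h i < h j}} \<le> card I - k"
proof (cases "{j \<in> I. k \<le> card {i \<in> I. h i < h j}} = {}")
  case False
  define J where "J = {j \<in> I. k \<le> card {i \<in> I. h i < h j}}"
  have fin: "finite J" using assms by (simp add: J_def)
  obtain j where j: "j \<in> J" "\<And>i. i \<in> J \<Longrightarrow> h j \<le> h i"
    using False fin by (metis J_def arg_min_if_finite(1,2) linorder_not_le)
  have sub: "J \<subseteq> I - {i \<in> I. h i < h j}"
    using j(2) by (force simp: J_def)
  have "card J \<le> card (I - {i \<in> I. h i < h j})"
    using sub assms by (intro card_mono) auto
  also have "\<dots> = card I - card {i \<in> I. h i < h j}"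
    using assms by (intro card_Diff_subset) auto
  also have "\<dots> \<le> card I - k"
    using j(1) by (auto simp: J_def)
  finally show ?thesis by (simp add: J_def)
qed (use assms in \<open>metis card.empty zero_le\<close>)

text \<open>By exchangeability the event "at least \<open>k\<close> values lie strictly below the
  value at \<open>l\<close>" has the same probability for every \<open>l\<close>. Summing over
  \<open>l\<close> gives the expected number of such indices, which \<open>card_rank_ge_le\<close>
  bounds pointwise. Ties need no care because the comparison is strict.\<close>

lemma iid_rank_bound:
  fixes h :: "'a \<Rightarrow> real"
  assumes "prob_space \<mu>" and [measurable]: "h \<in> borel_measurable \<mu>"
    and "finite I" "j \<in> I" "k \<le> card I"
  defines "N \<equiv> (\<Pi>\<^sub>M i\<in>I. \<mu>)"
  shows "real (card I) * measure N {x \<in> space N. k \<le> card {i \<in> I. h (x i) < h (x j)}} \<le> card I - k"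
proof -
  interpret \<mu>: prob_space \<mu> by fact
  interpret N: prob_space N unfolding N_def by (intro prob_space_PiM assms(1))
  define E where "E j = {x \<in> space N. k \<le> card {i \<in> I. h (x i) < h (x j)}}" for j
  have E_sets [measurable]: "E j \<in> sets N" if "j \<in> I" for j
    unfolding E_def N_def pred_def[symmetric]
    using \<open>finite I\<close> by (rule pred_le_card_Collect) (use that in measurable)
  have same: "measure N (E l) = measure N (E j)" if l: "l \<in> I" for l
  proof -
    \<comment> \<open>Swapping the coordinates \<open>j\<close> and \<open>l\<close> preserves the
      product law and pulls \<open>E j\<close> back to \<open>E l\<close>.\<close>
    define \<tau> where "\<tau> = Transposition.transpose j l"
    have \<tau>: "bij_betw \<tau> I I"
      using l \<open>j \<in> I\<close> unfolding \<tau>_def by (simp add: bij_betw_transpose_iff)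
    then have \<tau>I: "inj_on \<tau> I" "\<tau> \<in> I \<rightarrow> I" by (auto simp: bij_betw_def)
    define T where "T = (\<lambda>\<omega>::'b \<Rightarrow> 'a. \<lambda>i\<in>I. \<omega> (\<tau> i))"
    have d: "distr N N T = N"
      using distr_PiM_reindex[of I "\<lambda>_. \<mu>" \<tau> I] \<tau>I assms(1) by (simp add: N_def T_def)
    have T_meas: "T \<in> N \<rightarrow>\<^sub>M N"
      unfolding T_def N_def using \<tau>I by (intro measurable_restrict measurable_component_singleton) auto
    have "T -` E j \<inter> space N = E l"
    proof -
      have "card {i \<in> I. h (T x i) < h (T x j)} = card {i \<in> I. h (x i) < h (x l)}" for x
      proof -
        have "{i \<in> I. h (x i) < h (x l)} = \<tau> ` {i \<in> I. h (T x i) < h (T x j)}"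
          using \<tau> \<open>j \<in> I\<close> by (auto simp: T_def \<tau>_def bij_betw_def image_iff Bex_def)
        then show ?thesis
          by (simp add: card_image inj_on_subset[OF \<tau>I(1)])
      qed
      then show ?thesis
        using measurable_space[OF T_meas] by (auto simp: E_def)
    qed
    then show ?thesis
      using measure_distr[OF T_meas E_sets[OF \<open>j \<in> I\<close>]] d by simp
  qed
  have "real (card I) * measure N (E j) = (\<Sum>l\<in>I. measure N (E l))"
    using same by simp
  \<comment> \<open>The integrand counts the indices \<open>l\<close> of large rank, so a pointwise
    bound on that count suffices.\<close>
  also have "\<dots> = (\<integral>x. (\<Sum>l\<in>I. indicator (E l) x) \<partial>N)"
    by (subst Bochner_Integration.integral_sum)
       (auto simp: E_def[symmetric] intro!: sum.cong integrable_real_indicator simp: N.emeasure_eq_measure)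
  also have "\<dots> \<le> (\<integral>x. real (card I - k) \<partial>N)"
  proof (rule integral_mono)
    fix x assume x: "x \<in> space N"
    have "(\<Sum>l\<in>I. indicator (E l) x :: real) = real (card {l \<in> I. x \<in> E l})"
      using \<open>finite I\<close> by (simp add: indicator_def sum.If_cases Int_def)
    also have "{l \<in> I. x \<in> E l} = {l \<in> I. k \<le> card {i \<in> I. h (x i) < h (x l)}}"
      using x by (auto simp: E_def)
    finally show "(\<Sum>l\<in>I. indicator (E l) x) \<le> real (card I - k)"
      using card_rank_ge_le[OF \<open>finite I\<close> \<open>k \<le> card I\<close>, of "\<lambda>i. h (x i)"] by simp
  qed (auto intro!: Bochner_Integration.integrable_sum integrable_real_indicator simp: N.emeasure_eq_measure)
  also have "\<dots> = real (card I - k)"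
    by (simp add: N.prob_space)
  finally show ?thesis by (simp add: E_def)
qed

section \<open>The split-conformal threshold and the margin\<close>

text \<open>Turns the infimum into a count of scores strictly below \<open>v\<close>. A level
  \<open>t\<close> below \<open>v\<close> that already captures enough scores exists exactly when
  enough scores lie strictly below \<open>v\<close>. The infinite threshold is covered: if the
  required count exceeds \<open>n\<close>, both sides hold for every \<open>v\<close>.\<close>

lemma le_split_conformal_threshold_iff:
  assumes "n \<ge> 1" "\<alpha> < 1"
  shows "ereal v \<le> split_conformal_threshold \<alpha> n S \<longleftrightarrow>
    card {i \<in> {1..n}. S i < v} < nat \<lceil>(1 - \<alpha>) * (real n + 1)\<rceil>"
proof -
  define k where "k = \<lceil>(1 - \<alpha>) * (real n + 1)\<rceil>"
  \<comment> \<open>This makes the set \<open>J\<close> below nonempty, so that its maximal score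
    exists.\<close>
  have "k \<ge> 1" using assms by (simp add: k_def)
  have set_eq: "{t. (1 / real n) * (\<Sum>i=1..n. of_bool (S i \<le> t)) \<ge> of_int k / real n}
      = {t. k \<le> int (card {i \<in> {1..n}. S i \<le> t})}"
  proof -
    have "(\<Sum>i=1..n. of_bool (S i \<le> t) :: real) = of_int (int (card {i \<in> {1..n}. S i \<le> t}))" for t
      by (simp add: of_bool_def sum.If_cases Int_def)
    then show ?thesis
      using \<open>n \<ge> 1\<close> by (simp add: divide_le_cancel del: of_int_of_nat_eq)
  qed
  have "ereal v \<le> split_conformal_threshold \<alpha> n S \<longleftrightarrow>
      (\<forall>t. k \<le> int (card {i \<in> {1..n}. S i \<le> t}) \<longrightarrow> v \<le> t)"
    unfolding split_conformal_threshold_def k_def[symmetric] set_eq by (auto simp: le_Inf_iff)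
  also have "\<dots> \<longleftrightarrow> int (card {i \<in> {1..n}. S i < v}) < k"
  proof (intro iffI allI impI)
    assume A: "\<forall>t. k \<le> int (card {i \<in> {1..n}. S i \<le> t}) \<longrightarrow> v \<le> t"
    show "int (card {i \<in> {1..n}. S i < v}) < k"
    proof (rule ccontr)
      assume B: "\<not> ?thesis"
      define J where "J = {i \<in> {1..n}. S i < v}"
      have "finite J" by (simp add: J_def)
      moreover have "card J \<noteq> 0" using B \<open>k \<ge> 1\<close> unfolding J_def[symmetric] by linarith
      ultimately have J: "finite J" "J \<noteq> {}" by auto
      \<comment> \<open>The largest score strictly below \<open>v\<close> captures all of
        \<open>J\<close>, so it is an admissible level smaller than \<open>v\<close>.\<close>
      define t where "t = Max (S ` J)"
      have "t < v" using J by (auto simp: t_def J_def)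
      have "J \<subseteq> {i \<in> {1..n}. S i \<le> t}" using J by (auto simp: t_def J_def)
      then have "card J \<le> card {i \<in> {1..n}. S i \<le> t}" by (intro card_mono) auto
      then have "k \<le> int (card {i \<in> {1..n}. S i \<le> t})" using B by (simp add: J_def)
      then show False using A \<open>t < v\<close> by (meson not_le)
    qed
  next
    fix t assume A: "int (card {i \<in> {1..n}. S i < v}) < k" and B: "k \<le> int (card {i \<in> {1..n}. S i \<le> t})"
    show "v \<le> t"
    proof (rule ccontr)
      assume "\<not> v \<le> t"
      then have "card {i \<in> {1..n}. S i \<le> t} \<le> card {i \<in> {1..n}. S i < v}"
        by (intro card_mono) auto
      then show False using A B by linarith
    qed
  qed
  finally show ?thesis by (simp add: k_def zless_nat_eq_int_zless)
qed

lemma mem_conformal_set_iff: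
  assumes "n \<ge> 1" "\<alpha> < 1"
  shows "y \<in> conformal_set Mf f \<alpha> n xs x \<longleftrightarrow>
    card {i \<in> {1..n}. score Mf (xs i) (f (xs i)) < score Mf x y} < nat \<lceil>(1 - \<alpha>) * (real n + 1)\<rceil>"
  using le_split_conformal_threshold_iff[OF assms] by (simp add: conformal_set_def)

lemma measurable_margin [measurable (raw)]:
  assumes [measurable]: "g \<in> M \<rightarrow>\<^sub>M borel" "Mf \<in> borel \<rightarrow>\<^sub>M borel" "y \<in> M \<rightarrow>\<^sub>M count_space UNIV"
  shows "(\<lambda>x. margin Mf (g x) (y x)) \<in> borel_measurable M"
proof -
  have comp: "(\<lambda>x. Mf (g x) $ k) \<in> borel_measurable M" for k
    by (rule borel_measurable_continuous_on[where f="\<lambda>v. v $ k"]) (auto intro: continuous_intros)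
  have "(\<lambda>x. margin Mf (g x) k) \<in> borel_measurable M" for k
    unfolding margin_def by (intro borel_measurable_diff borel_measurable_Max comp) auto
  \<comment> \<open>The label is itself a function of the argument, but it takes finitely many
    values, so measurability for each fixed label suffices.\<close>
  then show ?thesis
    by (rule measurable_compose_countable'[where I=UNIV]) (auto intro: countable_finite)
qed

lemma measurable_score [measurable (raw)]:
  assumes [measurable]: "g \<in> M \<rightarrow>\<^sub>M borel" "Mf \<in> borel \<rightarrow>\<^sub>M borel" "y \<in> M \<rightarrow>\<^sub>M count_space UNIV"
  shows "(\<lambda>x. score Mf (g x) (y x)) \<in> borel_measurable M"
  unfolding score_def by measurable

lemma margin_nonpos:
  assumes "induced_classifier Mf f" "f x \<noteq> y"
  shows "margin Mf x y \<le> 0"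
proof -
  have "Mf x $ y \<le> Mf x $ f x"
    using assms(1) by (auto simp: induced_classifier_def is_arg_max_def not_less)
  also have "\<dots> \<le> (MAX k\<in>UNIV - {y}. Mf x $ k)"
    using assms(2) by (intro Max_ge) auto
  finally show ?thesis by (simp add: margin_def)
qed

lemma ramp_bounds: "0 \<le> ramp t" "ramp t \<le> 1"
  by (auto simp: ramp_def)

lemma ramp_lipschitz: "\<bar>ramp s - ramp t\<bar> \<le> \<bar>s - t\<bar>"
  by (auto simp: ramp_def)

lemma measurable_ramp [measurable]: "ramp \<in> borel_measurable borel"
  unfolding ramp_def by measurable

section \<open>Ramp loss under couplings of the conditional laws\<close>

text \<open>The easy half of Kantorovich-Rubinstein duality: under any coupling the difference of
  the integrals is the mean of \<open>h (snd z) - h (fst z)\<close>, which the Lipschitz bound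
  controls by the transport cost. Then take the infimum over couplings.\<close>

lemma integral_diff_le_W1:
  fixes h :: "'x::{real_normed_vector, second_countable_topology} \<Rightarrow> real"
  assumes h[measurable]: "h \<in> borel_measurable borel" and bound: "\<And>x. \<bar>h x\<bar> \<le> B"
    and lip: "\<And>x x'. \<bar>h x - h x'\<bar> \<le> L * norm (x - x')"
    and "0 \<le> L" and \<mu>: "prob_space \<mu>" and fin: "W1 \<mu> \<nu> < \<infinity>"
  shows "integral\<^sup>L \<nu> h - integral\<^sup>L \<mu> h \<le> L * enn2real (W1 \<mu> \<nu>)"
proof -
  define D where "D = integral\<^sup>L \<nu> h - integral\<^sup>L \<mu> h"
  \<comment> \<open>The scale \<open>c\<close> will be \<open>L\<close>: dividing by it first makes
    \<open>D / L\<close> a lower bound for each transport cost, hence for the infimum, with no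
    constant to move through \<open>ennreal\<close>.\<close>
  have key: "D = (\<integral>z. h (snd z) - h (fst z) \<partial>\<pi>)
      \<and> ennreal (norm (\<integral>z. (h (snd z) - h (fst z)) / c \<partial>\<pi>)) \<le> (\<integral>\<^sup>+z. norm ((h (snd z) - h (fst z)) / c) \<partial>\<pi>)"
    if \<pi>: "\<pi> \<in> couplings \<mu> \<nu>" for \<pi> c
  proof -
    have s[measurable_cong]: "sets \<pi> = sets (borel \<Otimes>\<^sub>M borel)"
      and m: "distr \<pi> borel fst = \<mu>" "distr \<pi> borel snd = \<nu>"
      using \<pi> by (auto simp: couplings_def)
    \<comment> \<open>\<open>couplings\<close> does not state that its members have mass 1; this is
      inherited from the marginal \<open>\<mu>\<close>.\<close>
    have "prob_space \<pi>"
      using \<mu> unfolding m(1)[symmetric] by (rule prob_space_distrD[rotated]) measurable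
    then interpret \<pi>: prob_space \<pi> .
    have i: "integrable \<pi> (\<lambda>z. h (fst z))" "integrable \<pi> (\<lambda>z. h (snd z))"
      by (auto intro!: \<pi>.integrable_const_bound[where B=B] simp: bound)
    have "integral\<^sup>L \<nu> h = (\<integral>z. h (snd z) \<partial>\<pi>)" "integral\<^sup>L \<mu> h = (\<integral>z. h (fst z) \<partial>\<pi>)"
      unfolding m[symmetric] by (auto intro!: integral_distr)
    then have "D = (\<integral>z. h (snd z) - h (fst z) \<partial>\<pi>)"
      using i by (simp add: D_def)
    moreover have "integrable \<pi> (\<lambda>z. (h (snd z) - h (fst z)) / c)"
      using i by simp
    ultimately show ?thesis
      using integral_norm_bound_ennreal by blast
  qed
  \<comment> \<open>An infimum over no couplings would be infinite. The case \<open>L = 0\<close>,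
    where division by \<open>L\<close> is impossible, uses this one coupling to get
    \<open>D = 0\<close>.\<close>
  obtain \<pi>\<^sub>0 where \<pi>\<^sub>0: "\<pi>\<^sub>0 \<in> couplings \<mu> \<nu>"
    using fin by (auto simp: W1_def INF_less_iff)
  show ?thesis
  proof (cases "L = 0")
    case True
    then have "h (snd z) - h (fst z) = 0" for z
      using lip[of "snd z" "fst z"] by simp
    then show ?thesis using key[OF \<pi>\<^sub>0] True by (simp add: D_def)
  next
    case False
    with \<open>0 \<le> L\<close> have L: "L > 0" by simp
    have "ennreal (D / L) \<le> W1 \<mu> \<nu>"
      unfolding W1_def
    proof (rule INF_greatest)
      fix \<pi> assume \<pi>: "\<pi> \<in> couplings \<mu> \<nu>"
      have "ennreal (D / L) \<le> ennreal (norm (\<integral>z. (h (snd z) - h (fst z)) / L \<partial>\<pi>))"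
        using conjunct1[OF key[OF \<pi>, of L]] L by (intro ennreal_leI) (simp add: divide_right_mono)
      also have "\<dots> \<le> (\<integral>\<^sup>+z. norm ((h (snd z) - h (fst z)) / L) \<partial>\<pi>)"
        using key[OF \<pi>] by blast
      also have "\<dots> \<le> (\<integral>\<^sup>+z. ennreal (norm (fst z - snd z)) \<partial>\<pi>)"
        using lip L by (intro nn_integral_mono ennreal_leI)
          (simp add: divide_le_eq mult.commute[of _ L] norm_minus_commute[of "fst _"])
      finally show "ennreal (D / L) \<le> (\<integral>\<^sup>+z. ennreal (norm (fst z - snd z)) \<partial>\<pi>)" .
    qed
    \<comment> \<open>Finiteness matters here, since \<open>enn2real\<close> sends infinity to
      0.\<close>
    then have "D / L \<le> enn2real (W1 \<mu> \<nu>)"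
      using fin by (cases "W1 \<mu> \<nu>") (auto simp: ennreal_le_iff2)
    then show ?thesis using L by (simp add: D_def field_simps)
  qed
qed

text \<open>For each coupling, a probability measure, the mean distance is at most the essential
  supremum. This is how a bound on \<open>Winf\<close> yields finite \<open>W1\<close>.\<close>

lemma W1_le_Winf:
  fixes \<mu> \<nu> :: "'x::{real_normed_vector, second_countable_topology} measure"
  assumes "prob_space \<mu>"
  shows "W1 \<mu> \<nu> \<le> Winf \<mu> \<nu>"
  unfolding W1_def Winf_def
proof (rule INF_mono, intro bexI)
  fix \<pi> assume \<pi>: "\<pi> \<in> couplings \<mu> \<nu>"
  have s[measurable_cong]: "sets \<pi> = sets (borel \<Otimes>\<^sub>M borel)" and m: "distr \<pi> borel fst = \<mu>"
    using \<pi> by (auto simp: couplings_def)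
  have "prob_space \<pi>"
    using assms unfolding m[symmetric] by (rule prob_space_distrD[rotated]) measurable
  then interpret \<pi>: prob_space \<pi> .
  let ?f = "\<lambda>z. ennreal (norm (fst z - snd z))"
  have "(\<integral>\<^sup>+z. ?f z \<partial>\<pi>) \<le> (\<integral>\<^sup>+z. esssup \<pi> ?f \<partial>\<pi>)"
    by (intro nn_integral_mono_AE esssup_AE)
  then show "(\<integral>\<^sup>+z. ?f z \<partial>\<pi>) \<le> esssup \<pi> ?f"
    by (simp add: \<pi>.emeasure_space_1)
qed

text \<open>The law of total expectation over finitely many labels. A label of probability 0
  contributes 0 to both sides, although its \<open>cond_X\<close> is not a probability law.\<close>

lemma integral_label_disintegration:
  fixes P :: "('x::topological_space \<times> 'k::finite) measure" and g :: "'x \<Rightarrow> 'k \<Rightarrow> real"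
  assumes "prob_space P" and s[measurable_cong]: "sets P = sets labelled_space"
    and gm[measurable]: "\<And>y. (\<lambda>x. g x y) \<in> borel_measurable borel" and bound: "\<And>x y. \<bar>g x y\<bar> \<le> B"
  shows "(\<integral>z. g (fst z) (snd z) \<partial>P)
    = (\<Sum>y\<in>UNIV. measure (marginal_Y P) {y} * integral\<^sup>L (cond_X P y) (\<lambda>x. g x y))"
proof -
  interpret P: prob_space P by fact
  define A where "A y = {z \<in> space P. snd z = y}" for y
  have A[measurable]: "A y \<in> sets P" for y
    unfolding A_def by measurable
  have fst_meas: "fst \<in> uniform_measure P (A y) \<rightarrow>\<^sub>M borel" for y
    by measurable
  have term_eq: "(\<integral>z. indicator (A y) z * g (fst z) y \<partial>P)
      = measure (marginal_Y P) {y} * integral\<^sup>L (cond_X P y) (\<lambda>x. g x y)" for y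
  proof -
    have m: "measure (marginal_Y P) {y} = measure P (A y)"
      unfolding marginal_Y_def
      by (subst measure_distr) (auto simp: A_def vimage_def Int_def conj_commute)
    show ?thesis
    proof (cases "measure P (A y) = 0")
      case True
      then have "emeasure P (A y) = 0" by (simp add: P.emeasure_eq_measure)
      then have "AE z in P. z \<notin> A y" by (intro AE_not_in) (auto simp: null_sets_def)
      then have "(\<integral>z. indicator (A y) z * g (fst z) y \<partial>P) = 0"
        by (intro integral_eq_zero_AE) (auto elim: eventually_mono)
      then show ?thesis by (simp add: m True)
    next
      case False
      then have pos: "measure P (A y) > 0" by (simp add: zero_less_measure_iff)
      \<comment> \<open>Rewriting the conditional law with a real-valued density makes
        \<open>integral_density\<close> applicable.\<close>
      have "uniform_measure P (A y) = density P (\<lambda>z. ennreal (indicator (A y) z / measure P (A y)))"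
        unfolding uniform_measure_def using pos
        by (auto intro!: arg_cong[where f="density P"] simp: fun_eq_iff P.emeasure_eq_measure
              indicator_def divide_ennreal ennreal_1[symmetric] simp del: ennreal_1)
      then have "integral\<^sup>L (cond_X P y) (\<lambda>x. g x y)
          = (\<integral>z. (indicator (A y) z / measure P (A y)) *\<^sub>R g (fst z) y \<partial>P)"
        unfolding cond_X_def A_def[symmetric]
        by (subst integral_distr[OF fst_meas]) (auto simp: integral_density)
      also have "\<dots> = (\<integral>z. indicator (A y) z * g (fst z) y \<partial>P) / measure P (A y)"
        by simp
      finally show ?thesis using pos m by simp
    qed
  qed
  \<comment> \<open>The events \<open>A y\<close> partition the space, so exactly one summand
    survives at each point.\<close>
  have "(\<integral>z. g (fst z) (snd z) \<partial>P) = (\<integral>z. (\<Sum>y\<in>UNIV. indicator (A y) z * g (fst z) y) \<partial>P)"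
    by (intro Bochner_Integration.integral_cong)
       (auto simp: A_def indicator_def sum.delta if_distrib[of "\<lambda>x. x * _"] cong: if_cong)
  also have "\<dots> = (\<Sum>y\<in>UNIV. \<integral>z. indicator (A y) z * g (fst z) y \<partial>P)"
  proof (rule Bochner_Integration.integral_sum)
    fix y
    show "integrable P (\<lambda>z. indicator (A y) z * g (fst z) y)"
      using bound order_trans[OF abs_ge_zero bound]
      by (intro P.integrable_const_bound[where B=B]) (auto simp: indicator_def)
  qed
  finally show ?thesis by (simp add: term_eq)
qed

lemma prob_space_cond_X:
  fixes P :: "('x::topological_space \<times> 'k) measure"
  assumes "prob_space P" and s[measurable_cong]: "sets P = sets labelled_space"
    and "measure (marginal_Y P) {y} > 0"
  shows "prob_space (cond_X P y)"
proof -
  interpret P: prob_space P by fact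
  have "measure (marginal_Y P) {y} = measure P {z \<in> space P. snd z = y}"
    unfolding marginal_Y_def
    by (subst measure_distr) (auto simp: vimage_def Int_def conj_commute)
  then have "prob_space (uniform_measure P {z \<in> space P. snd z = y})"
    using assms(3) by (intro prob_space_uniform_measure) (auto simp: P.emeasure_eq_measure)
  then show ?thesis
    unfolding cond_X_def by (rule prob_space.prob_space_distr) measurable
qed

text \<open>Equal label marginals make both losses averages of conditional losses with the same
  weights \<open>p y\<close>, so they can be compared label by label through
  \<open>integral_diff_le_W1\<close>. Labels of weight 0 drop out.\<close>

lemma ramp_loss_shift:
  fixes P Q :: "('x::{real_normed_vector, second_countable_topology} \<times> 'k::finite) measure"
  assumes P: "prob_space P" "sets P = sets labelled_space"
    and Q: "prob_space Q" "sets Q = sets labelled_space"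
    and Mf[measurable]: "Mf \<in> borel \<rightarrow>\<^sub>M borel"
    and lip: "\<And>x x' y. \<bar>margin Mf x y - margin Mf x' y\<bar> \<le> L * norm (x - x')" and "0 \<le> L"
    and marg: "marginal_Y P = marginal_Y Q"
    and fin: "\<And>y. measure (marginal_Y P) {y} > 0 \<Longrightarrow> W1 (cond_X P y) (cond_X Q y) < \<infinity>"
  shows "ramp_loss Mf Q \<le> ramp_loss Mf P + L * rho_mix P Q"
proof -
  define g where "g x y = ramp (margin Mf x y)" for x and y :: 'k
  define p where "p y = measure (marginal_Y P) {y}" for y
  have g_meas [measurable]: "(\<lambda>x. g x y) \<in> borel_measurable borel" for y
    unfolding g_def by measurable
  have g_bound: "\<bar>g x y\<bar> \<le> 1" for x y
    using ramp_bounds by (simp add: g_def abs_le_iff order_trans[of "- _" 0])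
  have g_lip: "\<bar>g x y - g x' y\<bar> \<le> L * norm (x - x')" for x x' y
    unfolding g_def using ramp_lipschitz lip by (rule order_trans)
  have eP: "ramp_loss Mf P = (\<Sum>y\<in>UNIV. p y * integral\<^sup>L (cond_X P y) (\<lambda>x. g x y))"
    unfolding ramp_loss_def p_def g_def[symmetric]
    by (rule integral_label_disintegration[OF P g_meas g_bound])
  have eQ: "ramp_loss Mf Q = (\<Sum>y\<in>UNIV. p y * integral\<^sup>L (cond_X Q y) (\<lambda>x. g x y))"
    unfolding ramp_loss_def p_def marg g_def[symmetric]
    by (rule integral_label_disintegration[OF Q g_meas g_bound])
  have "p y * integral\<^sup>L (cond_X Q y) (\<lambda>x. g x y) \<le> p y * integral\<^sup>L (cond_X P y) (\<lambda>x. g x y)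
      + L * (p y * enn2real (W1 (cond_X P y) (cond_X Q y)))" for y
  proof (cases "p y = 0")
    case False
    then have pos: "p y > 0" by (simp add: p_def zero_less_measure_iff)
    have "integral\<^sup>L (cond_X Q y) (\<lambda>x. g x y) - integral\<^sup>L (cond_X P y) (\<lambda>x. g x y)
        \<le> L * enn2real (W1 (cond_X P y) (cond_X Q y))"
      using pos prob_space_cond_X[OF P, of y] fin[of y]
      by (intro integral_diff_le_W1[OF g_meas g_bound g_lip \<open>0 \<le> L\<close>]) (auto simp: p_def)
    from mult_left_mono[OF this, of "p y"] pos show ?thesis by (simp add: algebra_simps)
  qed simp
  then have "ramp_loss Mf Q \<le> (\<Sum>y\<in>UNIV. p y * integral\<^sup>L (cond_X P y) (\<lambda>x. g x y)
      + L * (p y * enn2real (W1 (cond_X P y) (cond_X Q y))))"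
    unfolding eQ by (rule sum_mono)
  also have "\<dots> = ramp_loss Mf P + L * rho_mix P Q"
    by (simp add: eP rho_mix_def p_def sum.distrib sum_distrib_left)
  finally show ?thesis .
qed

text \<open>The ramp loss dominates the 0-1 loss pointwise: a wrong prediction forces a nonpositive
  margin, where \<open>ramp\<close> is 1.\<close>

lemma misclassification_le_ramp_loss:
  fixes Q :: "('x::topological_space \<times> 'k::finite) measure"
  assumes "prob_space Q" and s[measurable_cong]: "sets Q = sets labelled_space"
    and Mf[measurable]: "Mf \<in> borel \<rightarrow>\<^sub>M borel"
    and f[measurable]: "f \<in> borel \<rightarrow>\<^sub>M count_space UNIV" and "induced_classifier Mf f"
  shows "measure Q {z \<in> space Q. f (fst z) \<noteq> snd z} \<le> ramp_loss Mf Q"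
proof -
  interpret Q: prob_space Q by fact
  define A where "A = {z \<in> space Q. f (fst z) \<noteq> snd z}"
  have A[measurable]: "A \<in> sets Q" unfolding A_def by measurable
  have "measure Q A = (\<integral>z. indicator A z \<partial>Q)"
    by simp
  also have "\<dots> \<le> ramp_loss Mf Q"
    unfolding ramp_loss_def
  proof (rule integral_mono)
    show "integrable Q (\<lambda>z. ramp (margin Mf (fst z) (snd z)))"
      using ramp_bounds by (intro Q.integrable_const_bound[where B=1]) auto
    show "indicator A z \<le> ramp (margin Mf (fst z) (snd z))" for z
      using margin_nonpos[OF assms(5), of "fst z" "snd z"]
      by (auto simp: indicator_def ramp_bounds A_def ramp_def)
  qed (simp add: Q.emeasure_eq_measure)
  finally show ?thesis by (simp add: A_def)
qed

section \<open>Independence\<close>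

text \<open>Events of \<open>g\<close> composed with \<open>B\<close> are events of
  \<open>B\<close>. Used to forget the test label and keep independence of the test
  covariate.\<close>

lemma indep_var_het_compose_right:
  assumes "prob_space M" "indep_var_het M Ma A Mb B" and g[measurable]: "g \<in> Mb \<rightarrow>\<^sub>M Mc"
  shows "indep_var_het M Ma A Mc (\<lambda>\<omega>. g (B \<omega>))"
proof -
  interpret prob_space M by fact
  have m[measurable]: "A \<in> M \<rightarrow>\<^sub>M Ma" "B \<in> M \<rightarrow>\<^sub>M Mb"
    and i: "indep_set {A -` S \<inter> space M | S. S \<in> sets Ma} {B -` S \<inter> space M | S. S \<in> sets Mb}"
    using assms(2) by (auto simp: indep_var_het_def)
  have "{(\<lambda>\<omega>. g (B \<omega>)) -` S \<inter> space M | S. S \<in> sets Mc} \<subseteq> {B -` S \<inter> space M | S. S \<in> sets Mb}"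
  proof clarify
    fix S assume "S \<in> sets Mc"
    then have "g -` S \<inter> space Mb \<in> sets Mb" using g by (rule measurable_sets[rotated])
    moreover have "(\<lambda>\<omega>. g (B \<omega>)) -` S \<inter> space M = B -` (g -` S \<inter> space Mb) \<inter> space M"
      using measurable_space[OF m(2)] by auto
    ultimately show "\<exists>T. (\<lambda>\<omega>. g (B \<omega>)) -` S \<inter> space M = B -` T \<inter> space M \<and> T \<in> sets Mb"
      by blast
  qed
  with i have "indep_set {A -` S \<inter> space M | S. S \<in> sets Ma} {(\<lambda>\<omega>. g (B \<omega>)) -` S \<inter> space M | S. S \<in> sets Mc}"
    unfolding indep_set_def
    by (intro indep_sets_mono_sets[OF i[unfolded indep_set_def]]) (auto split: bool.split)
  then show ?thesis by (simp add: indep_var_het_def)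
qed

text \<open>A product law is determined by boxes. A box over \<open>insert j I\<close> splits into
  an event of the block \<open>I\<close> and an event of \<open>X j\<close>, and independence
  factorises its probability.\<close>

lemma distr_PiM_insert_iid:
  assumes "prob_space M" "prob_space \<mu>" and sets: "sets \<mu> = sets N" and "finite I" "j \<notin> I"
    and vec: "distr M (\<Pi>\<^sub>M i\<in>I. N) (\<lambda>\<omega>. \<lambda>i\<in>I. X i \<omega>) = (\<Pi>\<^sub>M i\<in>I. \<mu>)"
    and last: "distr M N (X j) = \<mu>"
    and indep: "indep_var_het M (\<Pi>\<^sub>M i\<in>I. N) (\<lambda>\<omega>. \<lambda>i\<in>I. X i \<omega>) N (X j)"
  shows "distr M (\<Pi>\<^sub>M i\<in>insert j I. N) (\<lambda>\<omega>. \<lambda>i\<in>insert j I. X i \<omega>) = (\<Pi>\<^sub>M i\<in>insert j I. \<mu>)"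
proof -
  interpret prob_space M by fact
  interpret \<mu>: prob_space \<mu> by fact
  interpret prod: product_sigma_finite "\<lambda>_. \<mu>" ..
  show ?thesis
  proof (rule prod.PiM_eqI)
    have setsP: "sets (\<Pi>\<^sub>M i\<in>J. N) = sets (\<Pi>\<^sub>M i\<in>J. \<mu>)" for J :: "'c set"
      by (intro sets_PiM_cong refl) (simp add: sets)
    then show "sets (distr M (\<Pi>\<^sub>M i\<in>insert j I. N) (\<lambda>\<omega>. \<lambda>i\<in>insert j I. X i \<omega>)) = sets (\<Pi>\<^sub>M i\<in>insert j I. \<mu>)"
      by simp
    have vec_meas: "(\<lambda>\<omega>. \<lambda>i\<in>I. X i \<omega>) \<in> M \<rightarrow>\<^sub>M (\<Pi>\<^sub>M i\<in>I. N)" and last_meas: "X j \<in> M \<rightarrow>\<^sub>M N"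
      and ind: "indep_set {(\<lambda>\<omega>. \<lambda>i\<in>I. X i \<omega>) -` S \<inter> space M | S. S \<in> sets (\<Pi>\<^sub>M i\<in>I. N)}
         {X j -` S \<inter> space M | S. S \<in> sets N}"
      using indep by (auto simp: indep_var_het_def)
    have "X i \<in> M \<rightarrow>\<^sub>M N" if "i \<in> I" for i
      using measurable_compose[OF vec_meas measurable_component_singleton[OF that]] that by simp
    then have full_meas: "(\<lambda>\<omega>. \<lambda>i\<in>insert j I. X i \<omega>) \<in> M \<rightarrow>\<^sub>M (\<Pi>\<^sub>M i\<in>insert j I. N)"
      using last_meas by (intro measurable_restrict) auto
    fix A :: "'c \<Rightarrow> 'b set" assume A: "\<And>i. i \<in> insert j I \<Longrightarrow> A i \<in> sets \<mu>"
    have A': "A j \<in> sets N" "Pi\<^sub>E I A \<in> sets (\<Pi>\<^sub>M i\<in>I. N)" "Pi\<^sub>E (insert j I) A \<in> sets (\<Pi>\<^sub>M i\<in>insert j I. N)"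
      using A \<open>finite I\<close> by (auto simp: sets[symmetric] intro!: sets_PiM_I_finite)
    define U where "U = (\<lambda>\<omega>. \<lambda>i\<in>I. X i \<omega>) -` Pi\<^sub>E I A \<inter> space M"
    define V where "V = X j -` A j \<inter> space M"
    have "emeasure (distr M (\<Pi>\<^sub>M i\<in>insert j I. N) (\<lambda>\<omega>. \<lambda>i\<in>insert j I. X i \<omega>)) (Pi\<^sub>E (insert j I) A)
        = emeasure M ((\<lambda>\<omega>. \<lambda>i\<in>insert j I. X i \<omega>) -` Pi\<^sub>E (insert j I) A \<inter> space M)"
      by (rule emeasure_distr[OF full_meas A'(3)])
    also have "(\<lambda>\<omega>. \<lambda>i\<in>insert j I. X i \<omega>) -` Pi\<^sub>E (insert j I) A \<inter> space M = U \<inter> V"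
      by (auto simp: U_def V_def PiE_iff)
    also have "emeasure M (U \<inter> V) = emeasure M U * emeasure M V"
    proof -
      have "prob (U \<inter> V) = prob U * prob V"
        using A' by (intro indep_setD[OF ind]) (auto simp: U_def V_def)
      then show ?thesis by (simp add: emeasure_eq_measure ennreal_mult)
    qed
    also have "emeasure M U = (\<Prod>i\<in>I. emeasure \<mu> (A i))"
      using emeasure_distr[OF vec_meas A'(2)] A \<open>finite I\<close>
      unfolding vec U_def by (subst (asm) prod.emeasure_PiM) auto
    also have "emeasure M V = emeasure \<mu> (A j)"
      using emeasure_distr[OF last_meas A'(1)] by (simp add: last V_def)
    finally show "emeasure (distr M (\<Pi>\<^sub>M i\<in>insert j I. N) (\<lambda>\<omega>. \<lambda>i\<in>insert j I. X i \<omega>)) (Pi\<^sub>E (insert j I) A)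
        = (\<Prod>i\<in>insert j I. emeasure \<mu> (A i))"
      using \<open>finite I\<close> \<open>j \<notin> I\<close> by (simp add: mult.commute del: restrict_apply)
  qed (use \<open>finite I\<close> in simp)
qed

section \<open>Coverage of the conformal set built from predicted labels\<close>

theorem theorem1:
  fixes P Q :: "((real ^ 'd) \<times> 'k::finite) measure"
    and Mf :: "real ^ 'd \<Rightarrow> real ^ 'k"
    and f :: "real ^ 'd \<Rightarrow> 'k"
    and L\<gamma> \<rho> \<alpha> :: real
    and n :: nat
    and PQ :: "'w measure"
    and X :: "nat \<Rightarrow> 'w \<Rightarrow> real ^ 'd"
    and Y :: "'w \<Rightarrow> 'k"
  assumes K: "CARD('k) \<ge> 2"
    and P: "prob_space P" "sets P = sets labelled_space"
    and Q: "prob_space Q" "sets Q = sets labelled_space"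
    and Mf: "Mf \<in> borel \<rightarrow>\<^sub>M borel"
    and f: "f \<in> borel \<rightarrow>\<^sub>M count_space UNIV" "induced_classifier Mf f"
    and A1: "\<And>x x' y. \<bar>margin Mf x y - margin Mf x' y\<bar> \<le> L\<gamma> * norm (x - x')"
    and A2_marg: "marginal_Y P = marginal_Y Q"
    and A2_rho: "\<rho> > 0"
    and A2_Winf: "(SUP y\<in>{y. measure (marginal_Y P) {y} > 0}. Winf (cond_X P y) (cond_X Q y))
                    < ennreal \<rho>"
    and n: "n \<ge> 1"
    and \<alpha>: "0 < \<alpha>" "\<alpha> < 1"
    and PQ: "prob_space PQ"
    and X_indep: "prob_space.indep_vars PQ (\<lambda>_. borel) X {1..n}"
    and X_distr: "\<And>i. i \<in> {1..n} \<Longrightarrow> distr PQ borel (X i) = marginal_X Q"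
    and test_indep: "indep_var_het PQ
                       (\<Pi>\<^sub>M i\<in>{1..n}. borel) (\<lambda>\<omega>. \<lambda>i\<in>{1..n}. X i \<omega>)
                       labelled_space (\<lambda>\<omega>. (X (n + 1) \<omega>, Y \<omega>))"
    and test_distr: "distr PQ labelled_space (\<lambda>\<omega>. (X (n + 1) \<omega>, Y \<omega>)) = Q"
  shows "measure PQ {\<omega> \<in> space PQ. Y \<omega> \<in> conformal_set Mf f \<alpha> n (\<lambda>i. X i \<omega>) (X (n + 1) \<omega>)}
           \<ge> max 0 (1 - \<alpha> - ramp_loss Mf P - L\<gamma> * rho_mix P Q)
       \<and> measure PQ {\<omega> \<in> space PQ. Y \<omega> \<in> conformal_set Mf f \<alpha> n (\<lambda>i. X i \<omega>) (X (n + 1) \<omega>)}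
           \<ge> 1 - \<alpha> - ramp_loss Mf Q
       \<and> ramp_loss Mf Q \<le> ramp_loss Mf P + L\<gamma> * rho_mix P Q"
proof -
  interpret PQ: prob_space PQ by fact
  interpret Q: prob_space Q by fact
  note [measurable] = Mf f(1)
  define \<mu> where "\<mu> = marginal_X Q"
  define I where "I = {1..n}"
  define J where "J = insert (n + 1) I"
  define h where "h x = score Mf x (f x)" for x
  define k where "k = nat \<lceil>(1 - \<alpha>) * (real n + 1)\<rceil>"
  \<comment> \<open>The count runs over \<open>J\<close>, which includes the test index; that index
    never contributes, because the comparison is strict.\<close>
  define B where "B = {\<omega> \<in> space PQ. k \<le> card {i \<in> J. h (X i \<omega>) < h (X (n + 1) \<omega>)}}"
  define E where "E = {\<omega> \<in> space PQ. f (X (n + 1) \<omega>) \<noteq> Y \<omega>}"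
  define C where "C = {\<omega> \<in> space PQ. Y \<omega> \<in> conformal_set Mf f \<alpha> n (\<lambda>i. X i \<omega>) (X (n + 1) \<omega>)}"

  have Q_fst: "fst \<in> Q \<rightarrow>\<^sub>M borel"
    using measurable_fst by (simp add: Q(2) cong: measurable_cong_sets)
  have \<mu>: "prob_space \<mu>" "sets \<mu> = sets borel"
    using Q.prob_space_distr[OF Q_fst] by (auto simp: \<mu>_def marginal_X_def)
  have XY [measurable]: "(\<lambda>\<omega>. (X (n + 1) \<omega>, Y \<omega>)) \<in> PQ \<rightarrow>\<^sub>M labelled_space"
    using test_indep by (simp add: indep_var_het_def)
  have Y [measurable]: "Y \<in> PQ \<rightarrow>\<^sub>M count_space UNIV"
    using measurable_compose[OF XY measurable_snd] by simp
  have X_last: "X (n + 1) \<in> PQ \<rightarrow>\<^sub>M borel"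
    using measurable_compose[OF XY measurable_fst] by simp
  have X_meas [measurable]: "X i \<in> PQ \<rightarrow>\<^sub>M borel" if "i \<in> J" for i
    using that X_indep X_last unfolding J_def I_def PQ.indep_vars_def by auto
  have h_meas [measurable]: "h \<in> borel_measurable borel"
    unfolding h_def by measurable

  have vec: "distr PQ (\<Pi>\<^sub>M i\<in>I. borel) (\<lambda>\<omega>. \<lambda>i\<in>I. X i \<omega>) = (\<Pi>\<^sub>M i\<in>I. \<mu>)"
  proof -
    have "distr PQ (\<Pi>\<^sub>M i\<in>I. borel) (\<lambda>\<omega>. \<lambda>i\<in>I. X i \<omega>) = (\<Pi>\<^sub>M i\<in>I. distr PQ borel (X i))"
      using X_indep n X_meas
      by (subst (asm) PQ.indep_vars_iff_distr_eq_PiM') (auto simp: I_def J_def)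
    also have "\<dots> = (\<Pi>\<^sub>M i\<in>I. \<mu>)"
      using X_distr by (intro PiM_cong) (auto simp: I_def \<mu>_def)
    finally show ?thesis .
  qed
  have last: "distr PQ borel (X (n + 1)) = \<mu>"
  proof -
    have "\<mu> = distr (distr PQ labelled_space (\<lambda>\<omega>. (X (n + 1) \<omega>, Y \<omega>))) borel fst"
      unfolding \<mu>_def marginal_X_def test_distr ..
    also have "\<dots> = distr PQ borel (X (n + 1))"
      using XY by (subst distr_distr[OF measurable_fst]) (auto simp: comp_def)
    finally show ?thesis ..
  qed
  have joint: "distr PQ (\<Pi>\<^sub>M i\<in>J. borel) (\<lambda>\<omega>. \<lambda>i\<in>J. X i \<omega>) = (\<Pi>\<^sub>M i\<in>J. \<mu>)"
    unfolding J_def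
    using indep_var_het_compose_right[OF PQ test_indep measurable_fst]
    by (intro distr_PiM_insert_iid PQ \<mu> vec last) (auto simp: I_def)

  \<comment> \<open>This gives \<open>n + 1 - k \<le> (n + 1) * \<alpha>\<close>, the source of the
    level \<alpha>. The bound \<open>k_le\<close> below still admits \<open>k = n + 1\<close>, the
    case of an infinite threshold.\<close>
  have k_ge: "(1 - \<alpha>) * (real n + 1) \<le> real k"
    unfolding k_def by linarith
  have "(1 - \<alpha>) * (real n + 1) \<le> real n + 1"
    using \<alpha> by (simp add: mult_left_le_one_le)
  then have k_le: "k \<le> n + 1"
    unfolding k_def by linarith
  have card_J: "card J = n + 1" and fin_J: "finite J"
    by (auto simp: J_def I_def)

  have B_sets: "B \<in> sets PQ"
    unfolding B_def pred_def[symmetric]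
    by (rule pred_le_card_Collect[OF fin_J]) (use X_last in measurable)
  \<comment> \<open>\<open>B\<close> is the pullback of a rank event under the joint law of all
    \<open>n + 1\<close> covariates, which is a product law, so \<open>iid_rank_bound\<close>
    applies.\<close>
  have "measure PQ B \<le> \<alpha>"
  proof -
    let ?N = "\<Pi>\<^sub>M i\<in>J. \<mu>"
    define B' where "B' = {x \<in> space ?N. k \<le> card {i \<in> J. h (x i) < h (x (n + 1))}}"
    have T: "(\<lambda>\<omega>. \<lambda>i\<in>J. X i \<omega>) \<in> PQ \<rightarrow>\<^sub>M (\<Pi>\<^sub>M i\<in>J. borel)"
      by (intro measurable_restrict X_meas)
    have sN: "sets ?N = sets (\<Pi>\<^sub>M i\<in>J. borel)"
      by (intro sets_PiM_cong refl) (simp add: \<mu>)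
    have h\<mu>: "h \<in> borel_measurable \<mu>"
      using h_meas \<mu>(2) by (simp cong: measurable_cong_sets)
    have "n + 1 \<in> J" by (simp add: J_def)
    have B'_sets: "B' \<in> sets (\<Pi>\<^sub>M i\<in>J. borel)"
      unfolding B'_def sN[symmetric] pred_def[symmetric]
      by (rule pred_le_card_Collect[OF fin_J]) (use h\<mu> \<open>n + 1 \<in> J\<close> in measurable)
    have "(\<lambda>\<omega>. \<lambda>i\<in>J. X i \<omega>) -` B' \<inter> space PQ = B"
    proof -
      have "{i \<in> J. h ((\<lambda>i\<in>J. X i \<omega>) i) < h ((\<lambda>i\<in>J. X i \<omega>) (n + 1))}
          = {i \<in> J. h (X i \<omega>) < h (X (n + 1) \<omega>)}" for \<omega>
        using \<open>n + 1 \<in> J\<close> by auto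
      then show ?thesis
        using measurable_space[OF T] sets_eq_imp_space_eq[OF sN] by (auto simp: B_def B'_def)
    qed
    then have "measure PQ B = measure ?N B'"
      using measure_distr[OF T B'_sets] joint by simp
    moreover have "real (card J) * measure ?N B' \<le> card J - k"
      unfolding B'_def
      using k_le by (intro iid_rank_bound \<mu>(1) h\<mu> fin_J \<open>n + 1 \<in> J\<close>) (simp add: card_J)
    ultimately have "(real n + 1) * measure PQ B \<le> (real n + 1) - k"
      using k_le by (simp add: card_J of_nat_diff add.commute)
    also have "\<dots> \<le> (real n + 1) * \<alpha>"
      using k_ge by (simp add: algebra_simps)
    finally show ?thesis
      by (simp add: mult_le_cancel_left)
  qed

  have "E \<in> sets PQ"
    unfolding E_def using X_last by measurable
  have "measure PQ E \<le> ramp_loss Mf Q"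
  proof -
    have "{z \<in> space labelled_space. f (fst z) \<noteq> snd z} \<in> sets labelled_space"
      by measurable
    then have "measure Q {z \<in> space labelled_space. f (fst z) \<noteq> snd z} = measure PQ E"
      unfolding test_distr[symmetric]
      by (subst measure_distr[OF XY]) (auto simp: E_def space_pair_measure intro!: arg_cong[where f="measure PQ"])
    then show ?thesis
      using misclassification_le_ramp_loss[OF Q Mf f] sets_eq_imp_space_eq[OF Q(2)] by simp
  qed

  have C_eq: "C = {\<omega> \<in> space PQ. \<not> k \<le> card {i \<in> I. h (X i \<omega>) < score Mf (X (n + 1) \<omega>) (Y \<omega>)}}"
    unfolding C_def mem_conformal_set_iff[OF n \<alpha>(2)] h_def I_def k_def by (simp only: not_le)
  have "C \<in> sets PQ"
    unfolding C_eq pred_def[symmetric]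
  proof (intro pred_intros_logic pred_le_card_Collect)
    fix i assume "i \<in> I"
    then have [measurable]: "X i \<in> PQ \<rightarrow>\<^sub>M borel" by (simp add: J_def X_meas)
    note X_last[measurable]
    show "Measurable.pred PQ (\<lambda>\<omega>. h (X i \<omega>) < score Mf (X (n + 1) \<omega>) (Y \<omega>))"
      by measurable
  qed (simp add: I_def)
  \<comment> \<open>Off \<open>E\<close> the true label is the predicted one, so its score is
    \<open>h (X (n + 1) \<omega>)\<close>; off \<open>B\<close> fewer than \<open>k\<close> scores
    lie below that, which is membership in the conformal set.\<close>
  have "space PQ \<subseteq> C \<union> B \<union> E"
  proof
    fix \<omega> assume \<omega>: "\<omega> \<in> space PQ"
    have "\<omega> \<in> C" if "\<omega> \<notin> B" "\<omega> \<notin> E"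
    proof -
      have "score Mf (X (n + 1) \<omega>) (Y \<omega>) = h (X (n + 1) \<omega>)"
        using that \<omega> by (simp add: E_def h_def)
      moreover have "card {i \<in> I. h (X i \<omega>) < h (X (n + 1) \<omega>)} \<le> card {i \<in> J. h (X i \<omega>) < h (X (n + 1) \<omega>)}"
        using fin_J by (intro card_mono) (auto simp: J_def)
      moreover have "card {i \<in> J. h (X i \<omega>) < h (X (n + 1) \<omega>)} < k"
        using that \<omega> by (simp add: B_def)
      ultimately show ?thesis
        using \<omega> by (simp add: C_eq)
    qed
    then show "\<omega> \<in> C \<union> B \<union> E" by blast
  qed
  then have "measure PQ (space PQ) \<le> measure PQ (C \<union> B \<union> E)"
    using \<open>C \<in> sets PQ\<close> B_sets \<open>E \<in> sets PQ\<close> by (intro PQ.finite_measure_mono) auto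
  also have "\<dots> \<le> measure PQ C + measure PQ B + measure PQ E"
    using \<open>C \<in> sets PQ\<close> B_sets \<open>E \<in> sets PQ\<close>
    by (meson measure_Un_le add_right_mono order_trans sets.Un)
  finally have coverage: "measure PQ C \<ge> 1 - \<alpha> - ramp_loss Mf Q"
    using \<open>measure PQ B \<le> \<alpha>\<close> \<open>measure PQ E \<le> ramp_loss Mf Q\<close> by (simp add: PQ.prob_space)

  \<comment> \<open>Apply the Lipschitz bound to a unit vector and 0: its left side is an absolute
    value.\<close>
  have "0 \<le> L\<gamma>"
  proof -
    obtain x :: "real ^ 'd" where "norm x = 1" using vector_choose_size[of 1] by auto
    with A1[of x undefined 0] show ?thesis by simp
  qed
  \<comment> \<open>The bound by \<rho> on \<open>Winf\<close> ensures that \<open>enn2real\<close>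
    in \<open>rho_mix\<close> loses nothing on labels of positive probability.\<close>
  have "W1 (cond_X P y) (cond_X Q y) < \<infinity>" if "measure (marginal_Y P) {y} > 0" for y
  proof -
    have "W1 (cond_X P y) (cond_X Q y) \<le> Winf (cond_X P y) (cond_X Q y)"
      by (rule W1_le_Winf[OF prob_space_cond_X[OF P that]])
    also have "\<dots> \<le> (SUP y\<in>{y. measure (marginal_Y P) {y} > 0}. Winf (cond_X P y) (cond_X Q y))"
      using that by (intro SUP_upper) simp
    also have "\<dots> < \<infinity>"
      using A2_Winf by (rule order.strict_trans) simp
    finally show ?thesis .
  qed
  then have "ramp_loss Mf Q \<le> ramp_loss Mf P + L\<gamma> * rho_mix P Q"
    by (intro ramp_loss_shift[OF P Q Mf A1 \<open>0 \<le> L\<gamma>\<close> A2_marg])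
  \<comment> \<open>The 0 in the maximum is the nonnegativity of a probability; the other bound
    chains \<open>coverage\<close> with the loss comparison.\<close>
  with coverage show ?thesis
    unfolding C_def by auto
qed

end
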